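(* Let $(G_j)$ be a generalized Fibonacci sequence with arbitrary seeds $G_0,G_1$. Let $k$, $r$ and $n$ be nonnegative integers and let $w$ be a real or complex number such that $\sum_{s=0}^{n+1}\binom{n+1}{s}_F(-1)^{\lceil (n-s+1)/2\rceil}w^{n-s+1}\neq 0$. Then $$ \begin{aligned} \sum_{j=0}^k w^j j^r G_j^n &= A_n(w;r)\,G_0^n+\sum_{m=0}^r\binom rm A_n(w;m)\sum_{j=1}^n j^{r-m}w^jG_j^n\\ &\quad+\sum_{m=0}^r\binom rm A_n(w;m)\sum_{s=0}^{n}\binom{n+1}{s}_F(-1)^{\lceil (n-s+1)/2\rceil}\sum_{j=0}^{s-1}(j+n-s+1)^{r-m}w^{j+n-s+1}G_j^n\\ &\quad-\sum_{m=0}^r\binom rm A_n(w;m)\sum_{s=0}^{n+1}\binom{n+1}{s}_F(-1)^{\lceil (n-s+1)/2\rceil}\sum_{j=k+1}^{k+s}(j+n-s+1)^{r-m}w^{j+n-s+1}G_j^n , \end{aligned} $$ where the numbers $A_n(w;m)$, $m=0,1,\ldots,r$, are given recursively by $$ A_n(w;m)\sum_{s=0}^{n+1}\binom{n+1}{s}_F(-1)^{\lceil (n-s+1)/2\rceil}w^{n-s+1} =\delta_{m0}-\sum_{j=0}^{m-1}\binom mj A_n(w;j)\sum_{s=0}^{n}\binom{n+1}{s}_F(-1)^{\lceil (n-s+1)/2\rceil}(n-s+1)^{m-j}w^{n-s+1}. $$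
   Context: The generalized Fibonacci numbers are defined by $G_{i+1}=G_i+G_{i-1}$ for $i\ge 1$ with arbitrary (complex) seeds $G_0,G_1$; the Fibonacci numbers $F_i$ are the case $F_0=0$, $F_1=1$. The Fibonomial coefficients are $\binom pq_F=\prod_{j=1}^q \frac{F_{p-q+j}}{F_j}$ for integers $0\le q\le p$ (empty product equal to $1$). $\lceil u\rceil$ is the smallest integer greater than or equal to $u$, and $\delta_{ij}$ is the Kronecker delta. Conventions: $x^0=1$ for every $x$, including $x=0$; sums $\sum_{j=a}^{a-1}$ are empty and equal $0$. *)

theory Defs
  imports Complex_Main "HOL-Number_Theory.Fib"
begin

(* The library function gen_fib has natural number seeds only. *)
definition generalized_fib :: "(nat \<Rightarrow> 'a::semiring_1) \<Rightarrow> bool" where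
  "generalized_fib G \<longleftrightarrow> (\<forall>i\<ge>1. G (i + 1) = G i + G (i - 1))"

(* Meant for q \<le> p only: the subtraction p - q is truncated. *)
definition fibonomial :: "nat \<Rightarrow> nat \<Rightarrow> 'a::field_char_0" where
  "fibonomial p q = (\<Prod>j=1..q. of_nat (fib (p - q + j)) / of_nat (fib j))"

(* The exponent n - s + 1 is written n + 1 - s, so that on nat it is 0 (and not 1) for
   s = n + 1. *)
definition fib_sign :: "nat \<Rightarrow> nat \<Rightarrow> 'a::ring_1" where
  "fib_sign n s = (- 1) ^ nat \<lceil>real (n + 1 - s) / 2\<rceil>"

end

theory Submission
  imports Defs
begin

text \<open>
  The powers \<open>G j ^ n\<close> of a generalized Fibonacci sequence satisfy a linear recurrence of order
  \<open>n + 1\<close> with constant coefficients, namely the signed Fibonomials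
  \<open>c s = fibonomial (n+1) s * fib_sign n s\<close>: the sum of \<open>c s * G (j + s) ^ n\<close> over \<open>s \<le> n + 1\<close>
  vanishes for every \<open>j\<close> (\<open>fibonomial_recurrence\<close>).  It is proved by induction on \<open>n\<close>, without the
  roots of the characteristic polynomial: by the d'Ocagne type identity
  \<open>generalized_fib_interpolation\<close>, \<open>c\<close> of order \<open>n + 2\<close> times a further factor \<open>G (j + s)\<close> is a
  combination of \<open>c\<close> of order \<open>n + 1\<close> and its translate, whose coefficients do not depend on \<open>s\<close>.

  Multiplying the recurrence by \<open>(i + n + 1) ^ p * w ^ (i + n + 1)\<close>, summing over \<open>i \<le> k\<close> and
  putting \<open>j = i + s\<close> turns it into a sum over the windows \<open>s \<le> j \<le> k + s\<close>, in which the
  weight is \<open>(j + e) ^ p * w ^ (j + e)\<close> with \<open>e = n + 1 - s\<close>.  Each window differs from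
  \<open>0 \<le> j \<le> k\<close> by the two boundary ranges \<open>j < s\<close> and \<open>k < j \<le> k + s\<close>.  On \<open>0 \<le> j \<le> k\<close>
  the binomial theorem for \<open>(j + e) ^ p\<close> produces the binomial convolution of the moments
  \<open>B q = (\<Sum>s. c s * e ^ q * w ^ e)\<close> with the wanted sums \<open>S q = (\<Sum>j\<le>k. w ^ j * j ^ q * G j ^ n)\<close>.
  So the boundary terms \<open>T\<close> are the binomial convolution of \<open>B\<close> and \<open>S\<close>
  (\<open>boundary_terms_convolution\<close>).  The recursion for \<open>A\<close> says precisely that \<open>A\<close> is the inverse of
  \<open>B\<close> under binomial convolution, hence \<open>S\<close> is the convolution of \<open>A\<close> and \<open>T\<close>
  (\<open>binomial_convolution_cancel\<close>), which is the asserted formula.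
\<close>

section \<open>Binomial convolution\<close>

lemma binomial_convolution_assoc:
  fixes A B S :: "nat \<Rightarrow> 'a::comm_semiring_1"
  shows "(\<Sum>m\<le>r. of_nat (r choose m) * A m *
            (\<Sum>q\<le>r - m. of_nat ((r - m) choose q) * B q * S (r - m - q)))
       = (\<Sum>l\<le>r. of_nat (r choose l) *
            (\<Sum>m\<le>l. of_nat (l choose m) * A m * B (l - m)) * S (r - l))"
proof -
  let ?g = "\<lambda>m q. of_nat (r choose m) * A m * (of_nat ((r - m) choose q) * B q * S (r - m - q))"
  have "(\<Sum>m\<le>r. of_nat (r choose m) * A m *
            (\<Sum>q\<le>r - m. of_nat ((r - m) choose q) * B q * S (r - m - q)))
      = (\<Sum>m\<le>r. \<Sum>q\<le>r - m. ?g m q)"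
    by (simp add: sum_distrib_left)
  also have "\<dots> = (\<Sum>(m, q)\<in>(SIGMA m:{..r}. {..r - m}). ?g m q)"
    by (rule sum.Sigma) auto
  also have "(SIGMA m:{..r}. {..r - m}) = {(m, q). m + q \<le> r}"
    by auto
  also have "(\<Sum>(m, q)\<in>{(m, q). m + q \<le> r}. ?g m q) = (\<Sum>l\<le>r. \<Sum>m\<le>l. ?g m (l - m))"
    by (rule sum.triangle_reindex_eq)
  also have "\<dots> = (\<Sum>l\<le>r. of_nat (r choose l) *
      (\<Sum>m\<le>l. of_nat (l choose m) * A m * B (l - m)) * S (r - l))"
  proof (rule sum.cong[OF refl])
    fix l assume "l \<in> {..r}"
    have "?g m (l - m) = of_nat (r choose l) * (of_nat (l choose m) * A m * B (l - m)) * S (r - l)"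
      if "m \<le> l" for m
    proof -
      have choose: "of_nat (r choose m) * of_nat ((r - m) choose (l - m))
          = (of_nat (r choose l) * of_nat (l choose m) :: 'a)"
        using choose_mult[of m l r] that \<open>l \<in> {..r}\<close> by (simp flip: of_nat_mult)
      have "?g m (l - m) = (of_nat (r choose m) * of_nat ((r - m) choose (l - m)))
          * (A m * B (l - m) * S (r - l))"
        using that by (simp add: mult_ac)
      then show ?thesis
        unfolding choose by (simp only: mult_ac)
    qed
    then show "(\<Sum>m\<le>l. ?g m (l - m)) = of_nat (r choose l) *
        (\<Sum>m\<le>l. of_nat (l choose m) * A m * B (l - m)) * S (r - l)"
      by (simp add: sum_distrib_left sum_distrib_right)
  qed
  finally show ?thesis .
qed

lemma binomial_convolution_cancel:
  fixes A B S :: "nat \<Rightarrow> 'a::comm_semiring_1"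
  assumes inverse: "\<And>l. l \<le> r \<Longrightarrow>
    (\<Sum>m\<le>l. of_nat (l choose m) * A m * B (l - m)) = (if l = 0 then 1 else 0)"
  shows "(\<Sum>m\<le>r. of_nat (r choose m) * A m *
            (\<Sum>q\<le>r - m. of_nat ((r - m) choose q) * B q * S (r - m - q))) = S r"
proof -
  have "(\<Sum>l\<le>r. of_nat (r choose l) *
            (\<Sum>m\<le>l. of_nat (l choose m) * A m * B (l - m)) * S (r - l))
      = (\<Sum>l\<le>r. if l = 0 then S r else 0)"
    by (rule sum.cong) (auto simp: inverse)
  then show ?thesis
    unfolding binomial_convolution_assoc by simp
qed

section \<open>Fibonomial coefficients and their signs\<close>

lemma fibonomial_absorb_Suc:
  assumes "s \<le> p"
  shows "of_nat (fib (p + 1)) * (fibonomial p s :: 'a::field_char_0)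
       = of_nat (fib (s + 1)) * fibonomial (p + 1) (s + 1)"
proof -
  have "of_nat (fib (s + 1)) \<noteq> (0 :: 'a)"
    using fib_neq_0_nat[of "s + 1"] by simp
  then show ?thesis
    using assms by (simp add: fibonomial_def)
qed

lemma fibonomial_absorb:
  assumes "s \<le> p"
  shows "of_nat (fib (p + 1)) * (fibonomial p s :: 'a::field_char_0)
       = of_nat (fib (p + 1 - s)) * fibonomial (p + 1) s"
proof -
  obtain a where p: "p = a + s"
    using assms le_Suc_ex by (metis add.commute)
  have "(\<Prod>j=1..s. of_nat (fib (a + j))) * of_nat (fib (a + s + 1))
      = of_nat (fib (a + 1)) * (\<Prod>j=1..s. of_nat (fib (a + 1 + j)) :: 'a)"
    by (induction s) (simp_all add: ac_simps)
  then show ?thesis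
    by (simp add: p fibonomial_def prod_dividef ac_simps)
qed

lemma fibonomial_diag: "fibonomial p p = (1 :: 'a::field_char_0)"
proof -
  have "of_nat (fib j) / of_nat (fib j) = (1 :: 'a)" if "j \<in> {1..p}" for j
    using that fib_neq_0_nat[of j] by simp
  then show ?thesis
    by (simp add: fibonomial_def)
qed

lemma fib_sign_eq: "fib_sign n s = (- 1) ^ ((n + 2 - s) div 2)" if "s \<le> n + 1"
proof -
  have "\<lceil>real m / 2\<rceil> = int ((m + 1) div 2)" for m
    by (cases "even m") (auto elim!: evenE oddE simp: ceiling_eq_iff)
  moreover have "n + 1 - s + 1 = n + 2 - s"
    using that by simp
  ultimately show ?thesis
    by (simp only: fib_sign_def nat_int)
qed

lemma fib_sign_diag: "fib_sign n (n + 1) = 1"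
  by (simp add: fib_sign_eq)

lemma fib_sign_Suc_Suc: "fib_sign (n + 1) (s + 1) = fib_sign n s"
  by (simp add: fib_sign_def)

lemma fib_sign_Suc:
  assumes "s \<le> n + 1"
  shows "fib_sign (n + 1) s = (- 1) ^ (n + s) * (fib_sign n s :: 'a::ring_1)"
proof -
  obtain t where t: "n + 1 = s + t"
    using assms le_Suc_ex by blast
  then have "fib_sign (n + 1) s = (- 1 :: 'a) ^ ((t + 2) div 2)"
    and "fib_sign n s = (- 1 :: 'a) ^ ((t + 1) div 2)"
    using fib_sign_eq[of s "n + 1"] fib_sign_eq[of s n] by (simp_all add: numeral_eq_Suc)
  moreover have "(- 1 :: 'a) ^ (n + s) = (- 1) ^ (t + 1)"
  proof -
    have "n + s + (t + 1) = 2 * (n + 1)"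
      using t by simp
    then have "even (n + s) = even (t + 1)"
      by (metis dvd_triv_left even_add)
    then show ?thesis
      by (simp add: minus_one_power_iff)
  qed
  moreover have "(- 1 :: 'a) ^ ((t + 2) div 2) = (- 1) ^ (t + 1) * (- 1) ^ ((t + 1) div 2)"
    by (cases "even t") (auto elim!: evenE oddE)
  ultimately show ?thesis
    by simp
qed

section \<open>The recurrence for powers of a generalized Fibonacci sequence\<close>

lemma generalized_fib_step:
  assumes "generalized_fib G"
  shows "G (Suc (Suc i)) = G (Suc i) + G i"
  using assms unfolding generalized_fib_def by (metis Suc_eq_plus1 diff_Suc_1 le_add2)

text \<open>
  In characteristic zero, a solution of the Fibonacci recurrence is determined by its values at two
  distinct positions \<open>j\<close> and \<open>j + N\<close>, because \<open>fib N\<close> does not vanish.  With \<open>N = s + t\<close> fixed, the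
  two interpolating solutions are, as functions of \<open>s\<close>, \<open>fib s\<close> and up to a constant sign the
  Fibonacci number of the negative index \<open>s - N\<close>; the latter is \<open>(- 1) ^ s * fib t\<close>.
\<close>

lemma generalized_fib_interpolation:
  fixes G :: "nat \<Rightarrow> 'a::comm_ring_1"
  assumes "generalized_fib G"
  shows "of_nat (fib (s + t)) * G (j + s)
       = (- 1) ^ s * of_nat (fib t) * G j + of_nat (fib s) * G (j + s + t)"
proof -
  note step = generalized_fib_step[OF assms]
  have t1: "of_nat (fib (Suc s)) * G (j + s) = (- 1) ^ s * G j + of_nat (fib s) * G (Suc (j + s))"
  proof (induction s)
    case 0
    then show ?case by simp
  next
    case (Suc s)
    then show ?case by (simp add: step algebra_simps)
  qed
  \<comment> \<open>For fixed \<open>s\<close> both sides solve the Fibonacci recurrence in \<open>t\<close>.\<close>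
  show ?thesis
  proof (induction t rule: fib.induct)
    case 1
    then show ?case by simp
  next
    case 2
    then show ?case using t1 by simp
  next
    case (3 t)
    then show ?case by (simp add: step algebra_simps)
  qed
qed

text \<open>
  Both Fibonomials on the right are proportional to the one on the left, with factors
  \<open>fib (n + 2 - s) / fib (n + 2)\<close> and \<open>fib s / fib (n + 2)\<close>, and the signs match those in the
  interpolation of \<open>G (j + s)\<close> from \<open>G j\<close> and \<open>G (j + n + 2)\<close>.  The conditionals discard the terms
  at the ends, where truncated subtraction would give nonzero values.
\<close>

lemma signed_fibonomial_mult_generalized_fib:
  fixes G :: "nat \<Rightarrow> 'a::field_char_0"
  assumes G: "generalized_fib G" and s: "s \<le> n + 2"
  shows "fibonomial (n + 2) s * fib_sign (n + 1) s * G (j + s)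
       = (if s \<le> n + 1 then (- 1) ^ n * G j * (fibonomial (n + 1) s * fib_sign n s) else 0)
       + (if s = 0 then 0
          else G (j + n + 2) * (fibonomial (n + 1) (s - 1) * fib_sign n (s - 1)))"
    (is "?L = ?X + ?Y")
proof -
  let ?F = "of_nat (fib (n + 2)) :: 'a" and ?c = "fibonomial (n + 2) s * fib_sign (n + 1) s :: 'a"
  have F: "?F \<noteq> 0"
    using fib_neq_0_nat[of "n + 2"] by (simp del: fib.simps)
  have X: "?F * ?X = ?c * ((- 1) ^ s * of_nat (fib (n + 2 - s)) * G j)"
  proof (cases "s \<le> n + 1")
    case True
    have absorb: "?F * fibonomial (n + 1) s = of_nat (fib (n + 2 - s)) * fibonomial (n + 2) s"
      using fibonomial_absorb[OF True, where 'a = 'a] by (simp del: fib.simps)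
    have sign: "(- 1) ^ n * fib_sign n s = (- 1) ^ s * (fib_sign (n + 1) s :: 'a)"
      unfolding fib_sign_Suc[OF True] by (simp add: power_add)
    have "?F * ?X = (?F * fibonomial (n + 1) s) * ((- 1) ^ n * fib_sign n s) * G j"
      using True by (simp only: if_True mult_ac)
    then show ?thesis
      unfolding absorb sign by (simp only: mult_ac)
  next
    case False
    then have "s = n + 2" using s by simp
    then show ?thesis by simp
  qed
  have Y: "?F * ?Y = ?c * (of_nat (fib s) * G (j + n + 2))"
  proof (cases s)
    case 0
    then show ?thesis by simp
  next
    case (Suc u)
    have absorb: "?F * fibonomial (n + 1) u = of_nat (fib s) * fibonomial (n + 2) s"
      using fibonomial_absorb_Suc[of u "n + 1", where 'a = 'a] s Suc by (simp del: fib.simps)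
    have sign: "fib_sign n u = (fib_sign (n + 1) s :: 'a)"
      using Suc fib_sign_Suc_Suc[of n u, where 'a = 'a] by simp
    have "?F * ?Y = (?F * fibonomial (n + 1) u) * fib_sign n u * G (j + n + 2)"
      using Suc by (simp del: fib.simps)
    then show ?thesis
      unfolding absorb sign by (simp only: mult_ac)
  qed
  have "s + (n + 2 - s) = n + 2"
    using s by simp
  then have "?F * ?L = ?c * (of_nat (fib (s + (n + 2 - s))) * G (j + s))"
    by (simp only: mult_ac)
  also have "\<dots> = ?c * ((- 1) ^ s * of_nat (fib (n + 2 - s)) * G j + of_nat (fib s) * G (j + n + 2))"
    unfolding generalized_fib_interpolation[OF G] using s by (simp add: add.assoc del: fib.simps)
  also have "\<dots> = ?F * (?X + ?Y)"
    by (simp only: distrib_left X Y)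
  finally show ?thesis
    using F by (metis mult_left_cancel)
qed

theorem fibonomial_recurrence:
  fixes G :: "nat \<Rightarrow> 'a::field_char_0"
  assumes G: "generalized_fib G"
  shows "(\<Sum>s\<le>n + 1. fibonomial (n + 1) s * fib_sign n s * G (j + s) ^ n) = 0"
proof (induction n arbitrary: j)
  case 0
  show ?case
    by (simp add: fibonomial_def fib_sign_eq)
next
  case (Suc n)
  let ?c = "\<lambda>s. fibonomial (n + 1) s * fib_sign n s :: 'a"
  have summand: "fibonomial (n + 2) s * fib_sign (n + 1) s * G (j + s) ^ (n + 1)
      = (if s \<le> n + 1 then (- 1) ^ n * G j * ?c s else 0) * G (j + s) ^ n
      + (if s = 0 then 0 else G (j + n + 2) * ?c (s - 1)) * G (j + s) ^ n"
    if "s \<le> n + 2" for s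
    unfolding distrib_right[symmetric] signed_fibonomial_mult_generalized_fib[OF G that, symmetric]
    by (simp add: mult.assoc)
  have "(\<Sum>s\<le>n + 2. fibonomial (n + 2) s * fib_sign (n + 1) s * G (j + s) ^ (n + 1))
      = (\<Sum>s\<le>n + 2. (if s \<le> n + 1 then (- 1) ^ n * G j * ?c s else 0) * G (j + s) ^ n)
      + (\<Sum>s\<le>n + 2. (if s = 0 then 0 else G (j + n + 2) * ?c (s - 1)) * G (j + s) ^ n)"
    unfolding sum.distrib[symmetric] by (rule sum.cong) (simp_all only: summand atMost_iff)
  also have "(\<Sum>s\<le>n + 2. (if s \<le> n + 1 then (- 1) ^ n * G j * ?c s else 0) * G (j + s) ^ n)
      = (- 1) ^ n * G j * (\<Sum>s\<le>n + 1. ?c s * G (j + s) ^ n)"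
    by (simp add: sum_distrib_left algebra_simps)
  also have "(\<Sum>s\<le>n + 2. (if s = 0 then 0 else G (j + n + 2) * ?c (s - 1)) * G (j + s) ^ n)
      = G (j + n + 2) * (\<Sum>s\<le>n + 1. ?c s * G (Suc j + s) ^ n)"
    using sum.atMost_Suc_shift[of
        "\<lambda>s. (if s = 0 then 0 else G (j + n + 2) * ?c (s - 1)) * G (j + s) ^ n" "n + 1"]
    by (simp add: sum_distrib_left mult.assoc del: sum.atMost_Suc)
  finally show ?case
    unfolding Suc.IH by simp
qed

section \<open>Boundary terms of the weighted sums\<close>

lemma sum_shifted_window:
  fixes f :: "nat \<Rightarrow> 'a::ab_group_add"
  shows "(\<Sum>i\<le>k. f (i + s)) = (\<Sum>j\<le>k. f j) + (\<Sum>j=k+1..k+s. f j) - (\<Sum>j<s. f j)"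
proof -
  have "(\<Sum>j<s. f j) + (\<Sum>i\<le>k. f (i + s)) = (\<Sum>j\<le>k. f j) + (\<Sum>j=k+1..k+s. f j)"
  proof (induction s)
    case 0
    then show ?case by simp
  next
    case (Suc s)
    have "f s + (\<Sum>i\<le>k. f (i + Suc s)) = (\<Sum>i\<le>k. f (i + s)) + f (k + Suc s)"
      using sum.atMost_Suc_shift[of "\<lambda>i. f (i + s)" k] by simp
    then have "(\<Sum>j<Suc s. f j) + (\<Sum>i\<le>k. f (i + Suc s))
        = (\<Sum>j<s. f j) + (\<Sum>i\<le>k. f (i + s)) + f (k + Suc s)"
      by (simp add: add.assoc)
    then show ?case
      unfolding Suc by (simp add: add.assoc)
  qed
  then show ?thesis
    by (simp add: algebra_simps)
qed

text \<open>
  If \<open>j\<close> ran over the whole window \<open>s \<le> j \<le> k + s\<close>, the double sum would vanish by the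
  recurrence: with \<open>j = i + s\<close> the exponent \<open>j + (N - s)\<close> is \<open>i + N\<close>, so that the weight does not
  depend on \<open>s\<close>.  Hence the boundary ranges on the left contribute the same as \<open>j \<le> k\<close>, where
  the binomial theorem separates \<open>j\<close> from \<open>s\<close>.
\<close>

lemma boundary_terms_convolution:
  fixes c G :: "nat \<Rightarrow> 'a::comm_ring_1"
  assumes rec: "\<And>i. (\<Sum>s\<le>N. c s * g (i + s)) = 0"
  shows "(\<Sum>s\<le>N. c s * (\<Sum>j<s. of_nat (j + (N - s)) ^ p * w ^ (j + (N - s)) * g j))
       - (\<Sum>s\<le>N. c s * (\<Sum>j=k+1..k+s. of_nat (j + (N - s)) ^ p * w ^ (j + (N - s)) * g j))
       = (\<Sum>q\<le>p. of_nat (p choose q) * (\<Sum>s\<le>N. c s * of_nat (N - s) ^ q * w ^ (N - s)) *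
            (\<Sum>j\<le>k. w ^ j * of_nat j ^ (p - q) * g j))"
proof -
  let ?f = "\<lambda>s j. of_nat (j + (N - s)) ^ p * w ^ (j + (N - s)) * g j"
  have window: "(\<Sum>i\<le>k. ?f s (i + s))
      = (\<Sum>j\<le>k. ?f s j) + (\<Sum>j=k+1..k+s. ?f s j) - (\<Sum>j<s. ?f s j)" for s
    by (rule sum_shifted_window)
  have rearrange: "z - y = x" if "x + y - z = 0" for x y z :: 'a
    using that by (simp add: algebra_simps)
  have "(\<Sum>s\<le>N. c s * (\<Sum>i\<le>k. ?f s (i + s)))
      = (\<Sum>i\<le>k. \<Sum>s\<le>N. of_nat (i + N) ^ p * w ^ (i + N) * (c s * g (i + s)))"
    unfolding sum_distrib_left by (subst sum.swap) (simp add: algebra_simps)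
  also have "\<dots> = 0"
    by (simp add: rec flip: sum_distrib_left)
  finally have "(\<Sum>s\<le>N. c s * (\<Sum>j<s. ?f s j)) - (\<Sum>s\<le>N. c s * (\<Sum>j=k+1..k+s. ?f s j))
      = (\<Sum>s\<le>N. c s * (\<Sum>j\<le>k. ?f s j))"
    unfolding window distrib_left right_diff_distrib sum.distrib sum_subtractf
    by (rule rearrange)
  also have "\<dots> = (\<Sum>s\<le>N. \<Sum>j\<le>k. \<Sum>q\<le>p. of_nat (p choose q) *
      (c s * of_nat (N - s) ^ q * w ^ (N - s)) * (w ^ j * of_nat j ^ (p - q) * g j))"
  proof -
    have "?f s j = (\<Sum>q\<le>p. of_nat (p choose q) * (of_nat (N - s) ^ q * w ^ (N - s)) *
        (w ^ j * of_nat j ^ (p - q) * g j))" for s j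
    proof -
      have "of_nat (j + (N - s)) ^ p
          = (\<Sum>q\<le>p. of_nat (p choose q) * of_nat (N - s) ^ q * (of_nat j ^ (p - q) :: 'a))"
        using binomial_ring[of "of_nat (N - s) :: 'a" "of_nat j" p] by (simp only: of_nat_add add.commute)
      then show ?thesis
        by (simp only: power_add sum_distrib_right) (rule sum.cong, simp_all add: mult_ac)
    qed
    then show ?thesis
      by (simp only: sum_distrib_left mult.assoc mult.left_commute)
  qed
  also have "\<dots> = (\<Sum>q\<le>p. \<Sum>s\<le>N. \<Sum>j\<le>k. of_nat (p choose q) *
      (c s * of_nat (N - s) ^ q * w ^ (N - s)) * (w ^ j * of_nat j ^ (p - q) * g j))"
    by (simp only: sum.swap[of _ "{..p}"])
  also have "\<dots> = (\<Sum>q\<le>p. of_nat (p choose q) * (\<Sum>s\<le>N. c s * of_nat (N - s) ^ q * w ^ (N - s)) *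
            (\<Sum>j\<le>k. w ^ j * of_nat j ^ (p - q) * g j))"
    by (simp only: sum_product mult.assoc flip: sum_distrib_left)
  finally show ?thesis .
qed

section \<open>Weighted sums of powers\<close>

theorem theorem3p2:
  fixes G :: "nat \<Rightarrow> complex" and k r n :: nat and w :: complex and A :: "nat \<Rightarrow> complex"
  assumes G: "generalized_fib G"
    and nz: "(\<Sum>s=0..n+1. fibonomial (n+1) s * fib_sign n s * w ^ (n + 1 - s)) \<noteq> 0"
    and A: "\<And>m. m \<le> r \<Longrightarrow>
      A m * (\<Sum>s=0..n+1. fibonomial (n+1) s * fib_sign n s * w ^ (n + 1 - s)) =
      (if m = 0 then 1 else 0)
      - (\<Sum>j<m. of_nat (m choose j) * A j *
          (\<Sum>s=0..n. fibonomial (n+1) s * fib_sign n s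
             * of_nat (n + 1 - s) ^ (m - j) * w ^ (n + 1 - s)))"
  shows "(\<Sum>j=0..k. w ^ j * of_nat j ^ r * G j ^ n) =
      A r * G 0 ^ n
      + (\<Sum>m=0..r. of_nat (r choose m) * A m *
          (\<Sum>j=1..n. of_nat j ^ (r - m) * w ^ j * G j ^ n))
      + (\<Sum>m=0..r. of_nat (r choose m) * A m *
          (\<Sum>s=0..n. fibonomial (n+1) s * fib_sign n s *
            (\<Sum>j<s. of_nat (j + (n + 1 - s)) ^ (r - m) * w ^ (j + (n + 1 - s)) * G j ^ n)))
      - (\<Sum>m=0..r. of_nat (r choose m) * A m *
          (\<Sum>s=0..n+1. fibonomial (n+1) s * fib_sign n s *
            (\<Sum>j=k+1..k+s. of_nat (j + (n + 1 - s)) ^ (r - m) * w ^ (j + (n + 1 - s)) * G j ^ n)))"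
proof -
  define c :: "nat \<Rightarrow> complex" where "c s = fibonomial (n+1) s * fib_sign n s" for s
  define B where "B q = (\<Sum>s\<le>n+1. c s * of_nat (n + 1 - s) ^ q * w ^ (n + 1 - s))" for q
  define S where "S q = (\<Sum>j\<le>k. w ^ j * of_nat j ^ q * G j ^ n)" for q
  define f where "f p s j = of_nat (j + (n + 1 - s)) ^ p * w ^ (j + (n + 1 - s)) * G j ^ n" for p s j
  have c_top: "c (n + 1) = 1"
    unfolding c_def fibonomial_diag fib_sign_diag by simp
  have inverse: "(\<Sum>m\<le>l. of_nat (l choose m) * A m * B (l - m)) = (if l = 0 then 1 else 0)"
    if "l \<le> r" for l
  proof -
    have B0: "B 0 = (\<Sum>s=0..n+1. fibonomial (n+1) s * fib_sign n s * w ^ (n + 1 - s))"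
      by (simp only: B_def c_def atLeast0AtMost power_0 mult_1_right)
    \<comment> \<open>The term \<open>s = n + 1\<close> of a moment of positive order is \<open>0\<close>, as \<open>n + 1 - s = 0\<close>.\<close>
    have B_pos: "B (l - m) = (\<Sum>s=0..n. fibonomial (n+1) s * fib_sign n s
             * of_nat (n + 1 - s) ^ (l - m) * w ^ (n + 1 - s))" if "m < l" for m
      using that by (simp add: B_def c_def atLeast0AtMost)
    have "(\<Sum>m\<le>l. of_nat (l choose m) * A m * B (l - m))
        = (\<Sum>m<l. of_nat (l choose m) * A m * B (l - m)) + A l * B 0"
      by (simp flip: lessThan_Suc_atMost)
    then show ?thesis
      unfolding B0 A[OF \<open>l \<le> r\<close>] by (simp add: B_pos)
  qed
  have boundary: "(\<Sum>s\<le>n+1. c s * (\<Sum>j<s. f p s j)) - (\<Sum>s\<le>n+1. c s * (\<Sum>j=k+1..k+s. f p s j))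
      = (\<Sum>q\<le>p. of_nat (p choose q) * B q * S (p - q))" for p
    unfolding f_def B_def S_def
    by (rule boundary_terms_convolution[where g = "\<lambda>j. G j ^ n"]) (simp only: c_def fibonomial_recurrence[OF G])
  \<comment> \<open>The term \<open>s = n + 1\<close> of the lower boundary carries weight \<open>j ^ p * w ^ j\<close>; splitting off its
    part \<open>j = 0\<close>, which vanishes unless \<open>p = 0\<close>, accounts for the first two terms of the
    formula.\<close>
  have lower: "(\<Sum>s\<le>n+1. c s * (\<Sum>j<s. f p s j))
      = 0 ^ p * G 0 ^ n + (\<Sum>j=1..n. of_nat j ^ p * w ^ j * G j ^ n) + (\<Sum>s\<le>n. c s * (\<Sum>j<s. f p s j))"
    for p
  proof -
    have "(\<Sum>j<n+1. f p (n+1) j) = 0 ^ p * G 0 ^ n + (\<Sum>j=1..n. of_nat j ^ p * w ^ j * G j ^ n)"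
      by (simp add: f_def lessThan_Suc_atMost sum.atMost_shift sum.atLeast1_atMost_eq
          del: sum.lessThan_Suc)
    then show ?thesis
      using c_top by simp
  qed
  have single: "(\<Sum>m\<le>r. of_nat (r choose m) * A m * (0 ^ (r - m) * G 0 ^ n)) = A r * G 0 ^ n"
  proof -
    have "(\<Sum>m\<le>r. of_nat (r choose m) * A m * (0 ^ (r - m) * G 0 ^ n))
        = (\<Sum>m\<le>r. if m = r then A r * G 0 ^ n else 0)"
      by (rule sum.cong) auto
    then show ?thesis by simp
  qed
  have "S r = (\<Sum>m\<le>r. of_nat (r choose m) * A m *
      (\<Sum>q\<le>r - m. of_nat ((r - m) choose q) * B q * S (r - m - q)))"
    by (rule binomial_convolution_cancel[OF inverse, symmetric])
  also have "\<dots> = (\<Sum>m\<le>r. of_nat (r choose m) * A m * (0 ^ (r - m) * G 0 ^ n))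
      + (\<Sum>m\<le>r. of_nat (r choose m) * A m * (\<Sum>j=1..n. of_nat j ^ (r - m) * w ^ j * G j ^ n))
      + (\<Sum>m\<le>r. of_nat (r choose m) * A m * (\<Sum>s\<le>n. c s * (\<Sum>j<s. f (r - m) s j)))
      - (\<Sum>m\<le>r. of_nat (r choose m) * A m * (\<Sum>s\<le>n+1. c s * (\<Sum>j=k+1..k+s. f (r - m) s j)))"
    unfolding boundary[symmetric] lower
    by (simp only: distrib_left right_diff_distrib sum.distrib sum_subtractf)
  finally show ?thesis
    unfolding single by (simp only: S_def c_def f_def atLeast0AtMost)
qed

end
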